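(* The approximation factor $1-1/e$ of the following greedy algorithm for MBC is tight: for every $\varepsilon>0$ there exists an instance of MBC with unit costs ($c\equiv 1$, budget $b=k$ a positive integer) on which some execution of the algorithm (i.e., for some choice among maximizers in the arg max steps) returns a set $H$ with $\operatorname{GBC}(H)\le (1-1/e+\varepsilon)\cdot\mathrm{OPT}$, where $\mathrm{OPT}$ is the optimum value of the instance. The algorithm: set $H:=\emptyset$. For each $C_0\subseteq V$ with $|C_0|\le 3$ and $c(C_0)\le b$: let $C:=C_0$ and $U:=V\setminus C_0$; while $U\neq\emptyset$, choose $u\in U$ maximizing $(\operatorname{GBC}(C\cup\{u\})-\operatorname{GBC}(C))/c(u)$, add $u$ to $C$ if $c(C\cup\{u\})\le b$, and remove $u$ from $U$; afterwards, if $\operatorname{GBC}(C)>\operatorname{GBC}(H)$ set $H:=C$. Return $H$.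
   Context: An instance of \textsc{Maximum Betweenness Centrality} (MBC) consists of an undirected connected graph $G=(V,E)$, node costs $c\colon V\to\mathbb{R}_{\ge 0}$ and a budget $b\ge 0$. For distinct $s,t\in V$ let $\sigma_{s,t}$ be the number of shortest $s$--$t$ paths, and for $C\subseteq V$ let $\sigma_{s,t}(C)$ be the number of shortest $s$--$t$ paths containing at least one node of $C$. The group betweenness centrality is $\operatorname{GBC}(C)=\sum_{s,t\in V,\ s\neq t}\sigma_{s,t}(C)/\sigma_{s,t}$. A set $C\subseteq V$ is feasible if $\sum_{v\in C}c(v)\le b$; the goal is to find a feasible $C$ maximizing $\operatorname{GBC}(C)$. This algorithm is known to always achieve $\operatorname{GBC}(H)\ge(1-1/e)\mathrm{OPT}$. *)

theory Defs
  imports Complex_Main "Graph_Theory.Graph_Theory"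
begin

text \<open>
  Following \<^theory>\<open>Graph_Theory.Digraph\<close>, a finite simple undirected graph is a finite symmetric
  digraph without loops and parallel arcs (locale \<^locale>\<open>graph\<close>). In such a graph a path is
  determined by its list of vertices, so that \<^const>\<open>vpath\<close> can be used to count paths.
\<close>

locale mbc_instance = graph G for G :: "('a, 'b) pre_digraph" (structure) +
  fixes c :: "'a \<Rightarrow> real" and b :: real
  assumes connected_graph: "Digraph_Component.connected G"
    and cost_nonneg: "v \<in> verts G \<Longrightarrow> 0 \<le> c v"
    and budget_nonneg: "0 \<le> b"

definition st_paths :: "('a, 'b) pre_digraph \<Rightarrow> 'a \<Rightarrow> 'a \<Rightarrow> 'a vwalk set" where
  "st_paths G s t = {p. vpath p G \<and> hd p = s \<and> last p = t}"

definition shortest_st_paths :: "('a, 'b) pre_digraph \<Rightarrow> 'a \<Rightarrow> 'a \<Rightarrow> 'a vwalk set" where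
  "shortest_st_paths G s t =
     {p \<in> st_paths G s t. \<forall>q \<in> st_paths G s t. vwalk_length p \<le> vwalk_length q}"

definition num_shortest :: "('a, 'b) pre_digraph \<Rightarrow> 'a \<Rightarrow> 'a \<Rightarrow> nat" where
  "num_shortest G s t = card (shortest_st_paths G s t)"

text \<open>The end points of a path belong to it, so a path is also hit by its own end points.\<close>

definition num_shortest_hit :: "('a, 'b) pre_digraph \<Rightarrow> 'a set \<Rightarrow> 'a \<Rightarrow> 'a \<Rightarrow> nat" where
  "num_shortest_hit G C s t = card {p \<in> shortest_st_paths G s t. set p \<inter> C \<noteq> {}}"

text \<open>The sum ranges over ordered pairs.\<close>

definition gbc :: "('a, 'b) pre_digraph \<Rightarrow> 'a set \<Rightarrow> real" where
  "gbc G C = (\<Sum>(s, t) \<in> {(s, t). s \<in> verts G \<and> t \<in> verts G \<and> s \<noteq> t}.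
     real (num_shortest_hit G C s t) / real (num_shortest G s t))"

definition mbc_feasible :: "('a, 'b) pre_digraph \<Rightarrow> ('a \<Rightarrow> real) \<Rightarrow> real \<Rightarrow> 'a set \<Rightarrow> bool" where
  "mbc_feasible G c b C \<longleftrightarrow> C \<subseteq> verts G \<and> (\<Sum>v\<in>C. c v) \<le> b"

definition mbc_opt :: "('a, 'b) pre_digraph \<Rightarrow> ('a \<Rightarrow> real) \<Rightarrow> real \<Rightarrow> real" where
  "mbc_opt G c b = Max (gbc G ` {C. mbc_feasible G c b C})"

text \<open>
  The greedy algorithm is nondeterministic, so it is given as a big-step relation.
  \<open>greedy_loop G c b C U D\<close>: started in the state \<open>(C, U)\<close>, some execution of the inner loop
  ends with the set \<open>D\<close>. As division by zero yields zero, nodes of cost zero get ratio zero; this is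
  immaterial for positive costs.
\<close>

inductive greedy_loop ::
  "('a, 'b) pre_digraph \<Rightarrow> ('a \<Rightarrow> real) \<Rightarrow> real \<Rightarrow> 'a set \<Rightarrow> 'a set \<Rightarrow> 'a set \<Rightarrow> bool"
  for G c b where
  finish: "greedy_loop G c b C {} C"
| step: "greedy_loop G c b C U D"
  if "is_arg_max (\<lambda>u. (gbc G (C \<union> {u}) - gbc G C) / c u) (\<lambda>u. u \<in> U) u"
    and "greedy_loop G c b
           (if (\<Sum>v \<in> C \<union> {u}. c v) \<le> b then C \<union> {u} else C) (U - {u}) D"

definition greedy_seeds ::
  "('a, 'b) pre_digraph \<Rightarrow> ('a \<Rightarrow> real) \<Rightarrow> real \<Rightarrow> 'a set set" where
  "greedy_seeds G c b = {C\<^sub>0. C\<^sub>0 \<subseteq> verts G \<and> card C\<^sub>0 \<le> 3 \<and> (\<Sum>v\<in>C\<^sub>0. c v) \<le> b}"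

text \<open>
  \<open>greedy_scan G c b S H R\<close>: with the initial sets in \<open>S\<close> still to be processed (in an unspecified
  order) and current best set \<open>H\<close>, some execution of the outer loop ends with the set \<open>R\<close>.
\<close>

inductive greedy_scan ::
  "('a, 'b) pre_digraph \<Rightarrow> ('a \<Rightarrow> real) \<Rightarrow> real \<Rightarrow> 'a set set \<Rightarrow> 'a set \<Rightarrow> 'a set \<Rightarrow> bool"
  for G c b where
  finish: "greedy_scan G c b {} H H"
| step: "greedy_scan G c b S H R"
  if "C\<^sub>0 \<in> S"
    and "greedy_loop G c b C\<^sub>0 (verts G - C\<^sub>0) C"
    and "greedy_scan G c b (S - {C\<^sub>0}) (if gbc G C > gbc G H then C else H) R"

definition greedy_returns ::
  "('a, 'b) pre_digraph \<Rightarrow> ('a \<Rightarrow> real) \<Rightarrow> real \<Rightarrow> 'a set \<Rightarrow> bool" where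
  "greedy_returns G c b H \<longleftrightarrow> greedy_scan G c b (greedy_seeds G c b) {} H"

end

theory Submission
  imports Defs "HOL-Real_Asymp.Real_Asymp"
begin

text \<open>
  The graph simulates a tight instance of maximum coverage. It has layers \<open>S\<close> (a clique), \<open>Q\<close>, \<open>X\<close>,
  \<open>T\<close> with \<open>|Q| = |X| = k\<close> and \<open>|S| = |T|\<^sup>2\<close>, where \<open>|T|\<close> is much larger than \<open>k\<close>, so that up to lower
  order terms only the pairs between \<open>S\<close> and \<open>T\<close> matter. A shortest path from \<open>s \<in> S\<close> to \<open>t \<in> T\<close>
  runs through an arbitrary node of \<open>Q\<close> and then, unless \<open>t\<close> lies in a small remainder block, through
  the one node \<open>\<kappa> t \<in> X\<close> responsible for \<open>t\<close>. Hence \<open>Q\<close> hits everything, whereas a set with \<open>j\<close>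
  nodes in \<open>Q\<close> that leaves a fraction \<open>\<alpha>\<close> of \<open>T\<close> without its node of \<open>X\<close> hits the fraction
  \<open>1 - (1 - j/k) \<alpha>\<close> of the paths.

  The blocks are geometric: with \<open>m = k - 4\<close>, each node of \<open>X\<close> takes \<open>1/m\<close> of what its predecessors
  leave. Once three nodes of \<open>Q\<close> have been chosen, a fresh node of \<open>X\<close> gains at least
  \<open>(k - 3)/(k m) \<alpha>\<close>, which strictly beats the gain \<open>\<alpha>/k\<close> of a fourth node of \<open>Q\<close>. So whatever
  the initial set, greedy ends with at most three nodes of \<open>Q\<close> and hits at most
  \<open>1 - (1 - 3/k) (1 - 1/m)\<^sup>k\<close>, which tends to \<open>1 - 1/e\<close>.
\<close>

section \<open>Greedy executions\<close>

lemma greedy_loop_total: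
  assumes "finite U"
  shows "\<exists>D. greedy_loop G c b C U D"
  using assms
proof (induction "card U" arbitrary: U C)
  case 0
  then have "U = {}" by simp
  then show ?case using greedy_loop.finish by metis
next
  case (Suc n)
  let ?f = "\<lambda>u. (gbc G (C \<union> {u}) - gbc G C) / c u"
  have "U \<noteq> {}" using Suc by auto
  then have "Max (?f ` U) \<in> ?f ` U" using Suc.prems by simp
  then obtain u where u: "u \<in> U" "Max (?f ` U) = ?f u" by blast
  have "?f v \<le> ?f u" if "v \<in> U" for v
    unfolding u(2)[symmetric] using that Suc.prems by (intro Max_ge) auto
  then have am: "is_arg_max ?f (\<lambda>u. u \<in> U) u"
    unfolding is_arg_max_def using u(1) by (auto simp: not_less)
  have "n = card (U - {u})" "finite (U - {u})"
    using Suc.hyps(2) Suc.prems u(1) by (simp_all add: card_Diff_singleton)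
  from Suc.hyps(1)[OF this] show ?case
    using greedy_loop.step[OF am] by blast
qed

text \<open>The outer loop only ever keeps its old set or takes the outcome of an inner run, so a
  property of the initial set and of all inner outcomes survives every update.\<close>

lemma greedy_scan_exists:
  assumes "finite W" "P H"
    and "\<And>C\<^sub>0 D. C\<^sub>0 \<in> W \<Longrightarrow> greedy_loop G c b C\<^sub>0 (verts G - C\<^sub>0) D \<Longrightarrow> P D"
    and fin: "finite (verts G)"
  shows "\<exists>R. greedy_scan G c b W H R \<and> P R"
  using assms(1-3)
proof (induction W arbitrary: H rule: finite_psubset_induct)
  case (psubset W)
  show ?case
  proof (cases "W = {}")
    case True
    then show ?thesis using psubset.prems greedy_scan.finish by metis
  next
    case False
    then obtain C\<^sub>0 where C0: "C\<^sub>0 \<in> W" by auto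
    obtain D where D: "greedy_loop G c b C\<^sub>0 (verts G - C\<^sub>0) D"
      using greedy_loop_total[OF finite_Diff[OF fin]] by metis
    let ?H = "if gbc G D > gbc G H then D else H"
    have "P ?H" using psubset.prems C0 D by auto
    moreover have "W - {C\<^sub>0} \<subset> W" using C0 by auto
    ultimately obtain R where "greedy_scan G c b (W - {C\<^sub>0}) ?H R" "P R"
      using psubset.IH[of "W - {C\<^sub>0}" ?H] psubset.prems(2) by (metis Diff_iff)
    then show ?thesis using greedy_scan.step[OF C0 D] by blast
  qed
qed

text \<open>With unit costs the ratio differs from \<open>gbc G (insert u C)\<close> by a constant,
  so the maximizers agree. While \<open>card C < k\<close> every picked node fits the budget, which
  preserves \<open>U = V - C\<close>; once \<open>card C = k\<close> the set \<open>C\<close> stays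
  fixed, whatever remains in \<open>U\<close>.\<close>

lemma greedy_loop_unit_cost_invariant:
  assumes "greedy_loop G (\<lambda>_. 1) (real k) C U D"
    and "finite V" "C \<subseteq> V" "card C \<le> k" "card C < k \<Longrightarrow> U = V - C" "P C"
    and step: "\<And>C u. \<lbrakk>P C; C \<subseteq> V; card C < k; is_arg_max (\<lambda>u. gbc G (insert u C)) (\<lambda>u. u \<in> V - C) u\<rbrakk>
      \<Longrightarrow> P (insert u C)"
  shows "D \<subseteq> V \<and> card D \<le> k \<and> P D"
  using assms(1-6)
proof (induction rule: greedy_loop.induct)
  case (finish C)
  then show ?case by simp
next
  case (step C U u D)
  show ?case
  proof (cases "card C < k")
    case True
    then have U: "U = V - C" using step.prems by simp
    have am: "is_arg_max (\<lambda>u. gbc G (insert u C)) (\<lambda>u. u \<in> V - C) u"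
      using step.hyps(1) unfolding U is_arg_max_def by simp
    then have u: "u \<in> V - C" by (simp add: is_arg_max_def)
    have finC: "finite C" using step.prems finite_subset by blast
    then have card: "card (insert u C) = Suc (card C)" using u by simp
    then have ifT: "(\<Sum>v \<in> C \<union> {u}. 1) \<le> real k" using True by simp
    have "P (insert u C)" using assms(7) step.prems True am by blast
    moreover have "U - {u} = V - insert u C" using U by auto
    ultimately show ?thesis
      using step.IH ifT card True u step.prems by simp
  next
    case False
    then have k: "card C = k" using step.prems by simp
    have finC: "finite C" using step.prems finite_subset by blast
    have "(if (\<Sum>v \<in> C \<union> {u}. 1) \<le> real k then C \<union> {u} else C) = C"
      using k finC by (auto simp: card_insert_if)
    then show ?thesis using step.IH step.prems False by simp
  qed
qed

section \<open>Betweenness in symmetric graphs\<close>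

lemma set_vwalk_arcs_rev: "set (vwalk_arcs (rev p)) = (set (vwalk_arcs p))\<inverse>"
proof (induction p)
  case (Cons x p)
  then show ?case
    by (cases "p = []") (auto simp: vwalk_arcs_append last_rev)
qed simp

text \<open>Reversal preserves length and node set. The symmetry of the summands of
  \<open>gbc\<close> rests on this, so that pairs in \<open>T \<times> S\<close> reduce to pairs in
  \<open>S \<times> T\<close>.\<close>

lemma st_paths_rev:
  assumes "symmetric G"
  shows "st_paths G t s = rev ` st_paths G s t"
proof -
  have *: "rev p \<in> st_paths G t s" if "p \<in> st_paths G s t" for p s t
    using that assms unfolding st_paths_def vpath_def vwalk_def symmetric_def
    by (auto simp: set_vwalk_arcs_rev hd_rev last_rev dest: symD)
  show ?thesis
  proof (intro equalityI subsetI)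
    fix p assume "p \<in> st_paths G t s"
    then have "rev p \<in> st_paths G s t" by (rule *)
    then show "p \<in> rev ` st_paths G s t" by (metis image_eqI rev_rev_ident)
  qed (use * in auto)
qed

lemma shortest_st_paths_rev:
  assumes "symmetric G"
  shows "shortest_st_paths G t s = rev ` shortest_st_paths G s t"
  unfolding shortest_st_paths_def st_paths_rev[OF assms, of t s] by auto

lemma
  assumes "symmetric G"
  shows num_shortest_commute: "num_shortest G t s = num_shortest G s t"
    and num_shortest_hit_commute: "num_shortest_hit G C t s = num_shortest_hit G C s t"
proof -
  note rev = shortest_st_paths_rev[OF assms, of t s]
  show "num_shortest G t s = num_shortest G s t"
    unfolding num_shortest_def rev by (simp add: card_image)
  have "{p \<in> shortest_st_paths G t s. set p \<inter> C \<noteq> {}} = rev ` {p \<in> shortest_st_paths G s t. set p \<inter> C \<noteq> {}}"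
    unfolding rev image_def by auto
  then show "num_shortest_hit G C t s = num_shortest_hit G C s t"
    unfolding num_shortest_hit_def by (simp add: card_image)
qed

definition hit_ratio :: "('a, 'b) pre_digraph \<Rightarrow> 'a set \<Rightarrow> 'a \<Rightarrow> 'a \<Rightarrow> real" where
  "hit_ratio G C s t = real (num_shortest_hit G C s t) / real (num_shortest G s t)"

lemma hit_ratio_nonneg [simp]: "0 \<le> hit_ratio G C s t"
  by (simp add: hit_ratio_def)

lemma hit_ratio_le_1: "hit_ratio G C s t \<le> 1"
proof (cases "num_shortest G s t = 0")
  case False
  \<comment> \<open>Infinite sets have \<open>card\<close> 0, so a nonzero count forces
    finiteness.\<close>
  then have "finite (shortest_st_paths G s t)"
    unfolding num_shortest_def using card.infinite by metis
  then have "num_shortest_hit G C s t \<le> num_shortest G s t"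
    unfolding num_shortest_def num_shortest_hit_def by (intro card_mono) auto
  then show ?thesis by (simp add: hit_ratio_def divide_le_eq)
qed (simp add: hit_ratio_def)

lemma hit_ratio_commute: "symmetric G \<Longrightarrow> hit_ratio G C t s = hit_ratio G C s t"
  unfolding hit_ratio_def by (simp only: num_shortest_commute num_shortest_hit_commute)

lemma gbc_eq_sum_hit_ratio:
  "gbc G C = (\<Sum>(s, t) \<in> {(s, t). s \<in> verts G \<and> t \<in> verts G \<and> s \<noteq> t}. hit_ratio G C s t)"
  unfolding gbc_def hit_ratio_def ..

lemma shortest_st_paths_adjacent:
  assumes "(u, v) \<in> arcs_ends G" "u \<in> verts G" "v \<in> verts G" "u \<noteq> v"
  shows "shortest_st_paths G u v = {[u, v]}"
proof -
  have mem: "[u, v] \<in> st_paths G u v"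
    using assms by (simp add: st_paths_def vpath_def vwalk_def)
  have at_least_2: "length p \<ge> 2 \<and> (length p = 2 \<longrightarrow> p = [u, v])" if p: "p \<in> st_paths G u v" for p
  proof -
    have "p \<noteq> []" "hd p = u" "last p = v"
      using p by (auto simp: st_paths_def vpath_def vwalk_def)
    then show ?thesis
      using assms(4) by (cases p; cases "tl p"; auto)
  qed
  show ?thesis
  proof (intro equalityI subsetI)
    fix p assume "p \<in> shortest_st_paths G u v"
    then have p: "p \<in> st_paths G u v" "length p - 1 \<le> 1"
      using mem by (auto simp: shortest_st_paths_def)
    from p(2) at_least_2[OF p(1)] show "p \<in> {[u, v]}" by auto
  next
    fix p assume "p \<in> {[u, v]}"
    moreover have "vwalk_length [u, v] \<le> vwalk_length q" if "q \<in> st_paths G u v" for q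
      using at_least_2[OF that] by auto
    ultimately show "p \<in> shortest_st_paths G u v"
      using mem by (simp add: shortest_st_paths_def)
  qed
qed

text \<open>The arc itself is the only shortest path. Hence a pair inside the clique
  \<open>S\<close> counts only if one of its end points is chosen, which makes the contribution of
  \<open>S \<times> S\<close> linear in \<open>card S\<close> for a bounded number of chosen
  nodes.\<close>

lemma hit_ratio_adjacent:
  assumes "(u, v) \<in> arcs_ends G" "u \<in> verts G" "v \<in> verts G" "u \<noteq> v"
  shows "hit_ratio G C u v = (if u \<in> C \<or> v \<in> C then 1 else 0)"
proof -
  have "{p \<in> {[u, v]}. set p \<inter> C \<noteq> {}} = (if u \<in> C \<or> v \<in> C then {[u, v]} else {})" by auto
  then show ?thesis
    unfolding hit_ratio_def num_shortest_def num_shortest_hit_def shortest_st_paths_adjacent[OF assms]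
    by simp
qed

section \<open>The layered graph\<close>

text \<open>The equation \<open>\<kappa> t = t\<close> encodes that \<open>t\<close> lies in the
  remainder block: such a target is joined directly to all of \<open>Q\<close>.\<close>

locale layered_graph =
  fixes S Q X T :: "'a set" and \<kappa> :: "'a \<Rightarrow> 'a"
  assumes finite_layers [simp]: "finite S" "finite Q" "finite X" "finite T"
    and nonempty: "S \<noteq> {}" "Q \<noteq> {}" "T \<noteq> {}"
    and disjoint: "S \<inter> Q = {}" "S \<inter> X = {}" "S \<inter> T = {}" "Q \<inter> X = {}" "Q \<inter> T = {}" "X \<inter> T = {}"
    and kappa: "t \<in> T \<Longrightarrow> \<kappa> t \<in> X \<or> \<kappa> t = t"
begin

definition E :: "('a \<times> 'a) set" where
  "E = {(u, v). u \<in> S \<and> v \<in> S \<and> u \<noteq> v} \<union> S \<times> Q \<union> Q \<times> X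
     \<union> {(u, t). t \<in> T \<and> (if \<kappa> t = t then u \<in> Q else u = \<kappa> t)}"

definition \<G> :: "('a, 'a \<times> 'a) pre_digraph" where
  "\<G> = \<lparr>verts = S \<union> Q \<union> X \<union> T, arcs = E \<union> E\<inverse>, tail = fst, head = snd\<rparr>"

lemma verts_G [simp]: "verts \<G> = S \<union> Q \<union> X \<union> T"
  and arcs_G [simp]: "arcs \<G> = E \<union> E\<inverse>"
  and tail_G [simp]: "tail \<G> = fst"
  and head_G [simp]: "head \<G> = snd"
  by (simp_all add: \<G>_def)

lemma arcs_ends_G [simp]: "arcs_ends \<G> = E \<union> E\<inverse>"
  by (simp add: arcs_ends_conv)

lemma kappa_cross:
  assumes "t \<in> T" "\<kappa> t \<noteq> t"
  shows "\<kappa> t \<in> X \<and> \<kappa> t \<notin> S \<and> \<kappa> t \<notin> Q \<and> \<kappa> t \<notin> T"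
  using kappa[OF assms(1)] assms(2) disjoint by auto

lemma E_irrefl: "(x, x) \<notin> E"
  using disjoint by (auto simp: E_def split: if_splits)

lemma E_verts: "E \<subseteq> verts \<G> \<times> verts \<G>"
  unfolding E_def using kappa by (auto split: if_splits)

lemma symmetric_G: "symmetric \<G>"
  by (auto simp: symmetric_def sym_def)

lemma graph_G: "graph \<G>"
proof
  show "finite (arcs \<G>)"
    using finite_subset[OF E_verts] by simp
  show "tail \<G> e \<noteq> head \<G> e" if "e \<in> arcs \<G>" for e
    using that E_irrefl by (cases e) auto
  show "\<And>e. e \<in> arcs \<G> \<Longrightarrow> tail \<G> e \<in> verts \<G>" "\<And>e. e \<in> arcs \<G> \<Longrightarrow> head \<G> e \<in> verts \<G>"
    using E_verts by auto
qed (use symmetric_G in \<open>auto simp: arc_to_ends_def\<close>)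

lemma connected_G: "Digraph_Component.connected \<G>"
proof -
  interpret graph \<G> by (rule graph_G)
  obtain o' where o: "o' \<in> Q" using nonempty by auto
  obtain s where s: "s \<in> S" using nonempty by auto
  have to: "u \<rightarrow>\<^sup>*\<^bsub>\<G>\<^esub> v" if "(u, v) \<in> E \<union> E\<inverse>" for u v
    using that by (intro reachable_adjI) simp
  have Q: "q \<rightarrow>\<^sup>*\<^bsub>\<G>\<^esub> o'" if "q \<in> Q" for q
    using reachable_trans[OF to[of q s] to[of s o']] that s o by (auto simp: E_def)
  have X: "x \<rightarrow>\<^sup>*\<^bsub>\<G>\<^esub> o'" if "x \<in> X" for x
    using that o by (intro to) (auto simp: E_def)
  have "u \<rightarrow>\<^sup>*\<^bsub>\<G>\<^esub> o'" if "u \<in> verts \<G>" for u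
  proof -
    consider "u \<in> S" | "u \<in> Q" | "u \<in> X" | "u \<in> T" using \<open>u \<in> verts \<G>\<close> by auto
    then show ?thesis
    proof cases
      case 1 then show ?thesis using o by (intro to) (auto simp: E_def)
    next
      case 4
      show ?thesis
      proof (cases "\<kappa> u = u")
        case True then show ?thesis using 4 o by (intro to) (auto simp: E_def)
      next
        case False
        have "u \<rightarrow>\<^sup>*\<^bsub>\<G>\<^esub> \<kappa> u" using 4 False by (intro to) (auto simp: E_def)
        then show ?thesis using X[of "\<kappa> u"] kappa[OF 4] False reachable_trans by blast
      qed
    qed (use Q X in auto)
  qed
  then have "u \<rightarrow>\<^sup>*\<^bsub>\<G>\<^esub> v" if "u \<in> verts \<G>" "v \<in> verts \<G>" for u v
    using that symmetric_reachable[OF symmetric_G] reachable_trans by blast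
  then have "strongly_connected \<G>"
    using nonempty by (intro strongly_connectedI) auto
  \<comment> \<open>Connectedness refers to the symmetric closure, which is \<open>\<G>\<close>
    itself because its arcs are pairs and already symmetric.\<close>
  moreover have "with_proj (mk_symmetric \<G>) = \<G>"
    by (auto simp: with_proj_def mk_symmetric_def \<G>_def)
  ultimately show ?thesis by (simp add: connected_def)
qed

lemma mbc_instance_G: "0 \<le> b \<Longrightarrow> mbc_instance \<G> (\<lambda>_. 1) b"
  using graph_G connected_G by (simp add: mbc_instance_def mbc_instance_axioms_def)

section \<open>Shortest paths between S and T\<close>

definition route :: "'a \<Rightarrow> 'a \<Rightarrow> 'a \<Rightarrow> 'a list" where
  "route s t q = (if \<kappa> t = t then [s, q, t] else [s, q, \<kappa> t, t])"

lemma set_route: "set (route s t q) = {s, q, \<kappa> t, t}"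
  by (auto simp: route_def)

lemma length_route: "length (route s t q) = (if \<kappa> t = t then 3 else 4)"
  by (simp add: route_def)

lemma inj_route: "inj (route s t)"
  by (auto simp: inj_def route_def split: if_splits)

lemma route_in_st_paths:
  assumes "s \<in> S" "t \<in> T" "q \<in> Q"
  shows "route s t q \<in> st_paths \<G> s t"
proof -
  have "s \<noteq> q" "s \<noteq> t" "q \<noteq> t" using assms disjoint by auto
  moreover have "\<kappa> t \<in> X" "\<kappa> t \<noteq> s" "\<kappa> t \<noteq> q" if "\<kappa> t \<noteq> t"
    using that assms kappa[of t] disjoint by auto
  ultimately show ?thesis
    using assms by (auto simp: route_def st_paths_def vpath_def vwalk_def E_def)
qed

text \<open>The second node is a neighbour of \<open>s\<close>, hence in \<open>S\<close> or
  \<open>Q\<close>, and the last but one is a neighbour of \<open>t\<close>. On three nodes these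
  coincide and lie in \<open>Q\<close>. On four nodes the third is \<open>\<kappa> t\<close> in
  \<open>X\<close>, whose neighbours lie in \<open>Q\<close> or \<open>T\<close>, so again the
  second is in \<open>Q\<close>.\<close>

lemma short_path_is_route:
  assumes "s \<in> S" "t \<in> T" "p \<in> st_paths \<G> s t" "length p \<le> length (route s t q)"
  shows "p \<in> route s t ` Q"
proof -
  have nS: "(a \<in> S \<or> a \<in> Q)" if "(s, a) \<in> E \<union> E\<inverse>" for a
    using that assms(1,2) disjoint unfolding E_def by (auto dest: kappa_cross split: if_splits)
  have nT: "if \<kappa> t = t then a \<in> Q else a = \<kappa> t" if "(a, t) \<in> E \<union> E\<inverse>" for a
    using that assms(1,2) disjoint unfolding E_def by (auto dest: kappa_cross split: if_splits)
  have nX: "a \<in> Q \<or> a \<in> T" if "(a, x) \<in> E \<union> E\<inverse>" "x \<in> X" for a x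
    using that disjoint unfolding E_def by (auto dest: kappa_cross split: if_splits)
  have p: "p \<noteq> []" "hd p = s" "last p = t" "set (vwalk_arcs p) \<subseteq> E \<union> E\<inverse>"
    using assms(3) by (auto simp: st_paths_def vpath_def vwalk_def)
  have st: "s \<noteq> t" "t \<notin> Q" "t \<notin> S" using assms(1,2) disjoint by auto
  obtain p' where p1: "p = s # p'" using p by (cases p) auto
  then obtain a p'' where p2: "p = s # a # p''" using p st by (cases p') auto
  then have "(s, a) \<in> E \<union> E\<inverse>" using p by auto
  then have a: "a \<in> S \<or> a \<in> Q" by (rule nS)
  then have "a \<noteq> t" using st by auto
  then obtain b p3 where p3: "p = s # a # b # p3" using p p2 by (cases p'') auto
  show ?thesis
  proof (cases "p3 = []")
    case True
    then have b: "b = t" using p p3 by simp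
    then have "(a, t) \<in> E \<union> E\<inverse>" using p p3 by auto
    from nT[OF this] have "\<kappa> t = t" "a \<in> Q"
      using a kappa[OF assms(2)] disjoint by (auto split: if_splits)
    then show ?thesis using b p3 True by (auto simp: route_def)
  next
    case False
    then have l: "length p \<ge> 4" using p3 by (cases p3) auto
    \<comment> \<open>Routes to remainder targets have only three nodes.\<close>
    then have nt: "\<kappa> t \<noteq> t" using assms(4) by (auto simp: length_route split: if_splits)
    then have "length p = 4" using l assms(4) by (simp add: length_route)
    then have p4: "p = [s, a, b, t]" using p p3 by (cases p3) auto
    then have arcs: "(a, b) \<in> E \<union> E\<inverse>" "(b, t) \<in> E \<union> E\<inverse>" using p by auto
    then have b: "b = \<kappa> t" using nT nt by simp
    then have "b \<in> X" using nt kappa[OF assms(2)] by auto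
    then have "a \<in> Q" using nX[OF arcs(1)] a disjoint by auto
    then show ?thesis using b p4 nt by (auto simp: route_def)
  qed
qed

lemma shortest_st_paths_route:
  assumes "s \<in> S" "t \<in> T"
  shows "shortest_st_paths \<G> s t = route s t ` Q"
proof (intro equalityI subsetI)
  obtain q where q: "q \<in> Q" using nonempty by auto
  fix p assume p: "p \<in> shortest_st_paths \<G> s t"
  then have "vwalk_length p \<le> vwalk_length (route s t q)"
    using route_in_st_paths[OF assms q] by (auto simp: shortest_st_paths_def simp del: vwalk_length_simp)
  \<comment> \<open>\<open>vwalk_length\<close> is a truncated \<open>length p - 1\<close>, so
    comparing lengths requires a nonempty route.\<close>
  moreover have "length (route s t q) \<ge> 3" by (simp add: length_route)
  ultimately have "length p \<le> length (route s t q)" by simp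
  then show "p \<in> route s t ` Q"
    using short_path_is_route assms p by (auto simp: shortest_st_paths_def)
next
  fix p assume "p \<in> route s t ` Q"
  then obtain q where q: "q \<in> Q" "p = route s t q" by auto
  have "vwalk_length p \<le> vwalk_length r" if r: "r \<in> st_paths \<G> s t" for r
  proof (rule ccontr)
    assume "\<not> ?thesis"
    then have "length r < length p" by simp
    then have "r \<in> route s t ` Q" using short_path_is_route[OF assms r, of q] q by simp
    then have "length r = length p" using q by (auto simp: length_route)
    then show False using \<open>length r < length p\<close> by simp
  qed
  then show "p \<in> shortest_st_paths \<G> s t"
    using route_in_st_paths[OF assms] q by (simp add: shortest_st_paths_def)
qed

lemma hit_ratio_route:
  assumes "s \<in> S" "t \<in> T"
  shows "hit_ratio \<G> C s t = card {q \<in> Q. {s, q, \<kappa> t, t} \<inter> C \<noteq> {}} / card Q"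
proof -
  have "{p \<in> route s t ` Q. set p \<inter> C \<noteq> {}} = route s t ` {q \<in> Q. {s, q, \<kappa> t, t} \<inter> C \<noteq> {}}"
    by (auto simp: set_route)
  then show ?thesis
    unfolding hit_ratio_def num_shortest_def num_shortest_hit_def shortest_st_paths_route[OF assms]
    using inj_route by (simp add: card_image inj_on_subset[OF inj_route])
qed

text \<open>The fraction of the \<open>s\<close>-\<open>t\<close> paths that \<open>C\<close> hits in an inner node.\<close>

definition through :: "'a set \<Rightarrow> 'a \<Rightarrow> real" where
  "through C t = (if \<kappa> t \<in> C \<inter> X then 1 else card (C \<inter> Q) / card Q)"

lemma through_nonneg: "0 \<le> through C t"
  by (simp add: through_def)

lemma hit_ratio_ge_through:
  assumes "s \<in> S" "t \<in> T"
  shows "through C t \<le> hit_ratio \<G> C s t"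
proof (cases "\<kappa> t \<in> C \<inter> X")
  case True
  then have "{q \<in> Q. {s, q, \<kappa> t, t} \<inter> C \<noteq> {}} = Q" by auto
  then show ?thesis using True nonempty by (simp add: hit_ratio_route[OF assms] through_def)
next
  case False
  have "card (C \<inter> Q) \<le> card {q \<in> Q. {s, q, \<kappa> t, t} \<inter> C \<noteq> {}}"
    by (intro card_mono) auto
  then show ?thesis
    using False unfolding hit_ratio_route[OF assms] through_def by (auto intro: divide_right_mono)
qed

text \<open>A chosen end point makes the right-hand side at least 1; without one, only inner nodes
  can be hit.\<close>

lemma hit_ratio_le_through:
  assumes "s \<in> S" "t \<in> T"
  shows "hit_ratio \<G> C s t \<le> through C t + of_bool (s \<in> C) + of_bool (t \<in> C)"
proof (cases "s \<in> C \<or> t \<in> C")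
  case True
  then show ?thesis
    using hit_ratio_le_1[of \<G> C s t] through_nonneg[of C t] by auto
next
  case False
  show ?thesis
  proof (cases "\<kappa> t \<in> C \<inter> X")
    case True
    then show ?thesis using hit_ratio_le_1[of \<G> C s t] by (simp add: through_def)
  next
    case ni: False
    \<comment> \<open>Outside \<open>X\<close> the value \<open>\<kappa> t\<close> can only be
      \<open>t\<close>, which is not chosen here.\<close>
    then have "\<kappa> t \<notin> C" using False kappa[OF assms(2)] by auto
    then have "{q \<in> Q. {s, q, \<kappa> t, t} \<inter> C \<noteq> {}} = C \<inter> Q" using False by auto
    then have "hit_ratio \<G> C s t = card (C \<inter> Q) / card Q"
      unfolding hit_ratio_route[OF assms] by (simp only:)
    moreover have "through C t = card (C \<inter> Q) / card Q" using ni by (simp only: through_def if_False)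
    ultimately show ?thesis by simp
  qed
qed

section \<open>Betweenness up to lower order terms\<close>

definition missed :: "'a set \<Rightarrow> nat" where
  "missed C = card {t \<in> T. \<kappa> t \<notin> C \<inter> X}"

text \<open>The mean of \<open>through C\<close> over \<open>T\<close>, as
  \<open>sum_through\<close> shows.\<close>

definition cov :: "'a set \<Rightarrow> real" where
  "cov C = 1 - (1 - card (C \<inter> Q) / card Q) * (missed C / card T)"

lemma sum_through: "(\<Sum>t\<in>T. through C t) = card T * cov C"
proof -
  let ?r = "1 - card (C \<inter> Q) / card Q"
  have "(\<Sum>t\<in>T. through C t) = (\<Sum>t\<in>T. 1 - (if \<kappa> t \<notin> C \<inter> X then ?r else 0))"
    by (intro sum.cong) (auto simp: through_def)
  also have "\<dots> = card T - (\<Sum>t\<in>{t\<in>T. \<kappa> t \<notin> C \<inter> X}. ?r)"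
    unfolding sum_subtractf sum.inter_filter[OF finite_layers(4), symmetric] by simp
  also have "\<dots> = card T - ?r * missed C"
    by (simp add: missed_def)
  also have "\<dots> = card T * cov C"
    using nonempty by (simp add: cov_def right_diff_distrib)
  finally show ?thesis .
qed

text \<open>The number of ordered pairs between \<open>S\<close> and \<open>T\<close>, in both
  directions.\<close>

abbreviation scale :: real where
  "scale \<equiv> 2 * real (card S) * real (card T)"

lemma gbc_ge: "scale * cov C \<le> gbc \<G> C"
proof -
  let ?h = "\<lambda>(s, t). hit_ratio \<G> C s t"
  have st: "(\<Sum>p\<in>S \<times> T. ?h p) \<ge> card S * card T * cov C"
  proof -
    have "(\<Sum>s\<in>S. \<Sum>t\<in>T. through C t) \<le> (\<Sum>s\<in>S. \<Sum>t\<in>T. hit_ratio \<G> C s t)"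
      by (intro sum_mono hit_ratio_ge_through)
    then show ?thesis by (simp add: sum_through sum.cartesian_product)
  qed
  have "(\<Sum>p\<in>T \<times> S. ?h p) = (\<Sum>p\<in>S \<times> T. ?h p)"
    by (rule sum.reindex_bij_witness[of _ prod.swap prod.swap])
      (auto simp: hit_ratio_commute[OF symmetric_G])
  then have "scale * cov C \<le> (\<Sum>p\<in>S \<times> T \<union> T \<times> S. ?h p)"
    using st disjoint by (subst sum.union_disjoint) auto
  also have "\<dots> \<le> gbc \<G> C"
    unfolding gbc_eq_sum_hit_ratio
    by (rule sum_mono2) (use disjoint in \<open>auto intro: finite_subset[of _ "verts \<G> \<times> verts \<G>"]\<close>)
  finally show ?thesis .
qed

lemma sum_hit_ratio_le_card:
  "finite P \<Longrightarrow> (\<Sum>(s, t)\<in>P. hit_ratio G C s t) \<le> card P"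
  using sum_bounded_above[of P "\<lambda>(s, t). hit_ratio G C s t" 1] hit_ratio_le_1 by fastforce

text \<open>The error terms bound, in this order: chosen end points of pairs between
  \<open>S\<close> and \<open>T\<close>, pairs inside the clique \<open>S\<close>, pairs between
  \<open>S\<close> and \<open>Q \<union> X\<close>, and pairs avoiding \<open>S\<close>. The last
  two count every pair as fully hit.\<close>

lemma gbc_le:
  assumes "C \<subseteq> verts \<G>" "card C \<le> k"
  shows "gbc \<G> C \<le> scale * cov C + (2 * k * (card S + card T) + 2 * k * card S
    + 2 * card S * (card Q + card X) + (card Q + card X + card T)\<^sup>2)"
proof -
  let ?h = "\<lambda>(s, t). hit_ratio \<G> C s t"
  let ?D = "{(s, t). s \<in> S \<and> t \<in> S \<and> s \<noteq> t}"
  let ?W = "Q \<union> X \<union> T" let ?Y = "Q \<union> X"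
  have finC: "finite C" using assms(1) by (rule finite_subset) simp
  have sum_bool: "(\<Sum>x\<in>A. of_bool (x \<in> C) :: real) \<le> k" if "finite A" for A
  proof -
    have "(\<Sum>x\<in>A. of_bool (x \<in> C) :: real) = card (A \<inter> C)"
      using that by simp
    also have "\<dots> \<le> card C" using finC by (intro of_nat_mono card_mono) auto
    finally show ?thesis using assms(2) by simp
  qed
  have st: "(\<Sum>p\<in>S \<times> T. ?h p) \<le> card S * card T * cov C + k * (card S + card T)"
  proof -
    have "(\<Sum>p\<in>S \<times> T. ?h p) = (\<Sum>s\<in>S. \<Sum>t\<in>T. hit_ratio \<G> C s t)"
      by (simp add: sum.cartesian_product)
    also have "\<dots> \<le> (\<Sum>s\<in>S. \<Sum>t\<in>T. through C t + of_bool (s \<in> C) + of_bool (t \<in> C))"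
      by (intro sum_mono hit_ratio_le_through)
    also have "\<dots> = card S * card T * cov C + card T * (\<Sum>s\<in>S. of_bool (s \<in> C) :: real)
        + card S * (\<Sum>t\<in>T. of_bool (t \<in> C) :: real)"
      by (simp add: sum.distrib sum_through sum_distrib_left del: sum_of_bool_eq)
    also have "\<dots> \<le> card S * card T * cov C + card T * real k + card S * real k"
      by (intro add_mono mult_left_mono sum_bool) auto
    finally show ?thesis by (simp add: algebra_simps)
  qed
  have ts: "(\<Sum>p\<in>T \<times> S. ?h p) = (\<Sum>p\<in>S \<times> T. ?h p)"
    by (rule sum.reindex_bij_witness[of _ prod.swap prod.swap])
      (auto simp: hit_ratio_commute[OF symmetric_G])
  have finD: "finite ?D" by (rule finite_subset[of _ "S \<times> S"]) auto
  have ss: "(\<Sum>p\<in>?D. ?h p) \<le> 2 * k * card S"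
  proof -
    have "(\<Sum>p\<in>?D. ?h p) \<le> (\<Sum>(s, t)\<in>?D. of_bool (s \<in> C) + of_bool (t \<in> C))"
      by (rule sum_mono) (auto simp: hit_ratio_adjacent E_def)
    also have "\<dots> \<le> (\<Sum>(s, t)\<in>S \<times> S. of_bool (s \<in> C) + of_bool (t \<in> C))"
      by (rule sum_mono2) auto
    also have "\<dots> = (\<Sum>s\<in>S. \<Sum>t\<in>S. of_bool (s \<in> C) + of_bool (t \<in> C))"
      by (simp add: sum.cartesian_product)
    also have "\<dots> = 2 * card S * (\<Sum>s\<in>S. of_bool (s \<in> C) :: real)"
      by (simp add: sum.distrib sum_distrib_left del: sum_of_bool_eq)
    also have "\<dots> \<le> 2 * card S * real k"
      by (intro mult_left_mono sum_bool) auto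
    finally show ?thesis by (simp add: algebra_simps)
  qed
  have sy: "(\<Sum>p\<in>S \<times> ?Y. ?h p) \<le> card S * (card Q + card X)"
    "(\<Sum>p\<in>?Y \<times> S. ?h p) \<le> card S * (card Q + card X)"
    using sum_hit_ratio_le_card[of "S \<times> ?Y" \<G> C] sum_hit_ratio_le_card[of "?Y \<times> S" \<G> C] disjoint
    by (simp_all add: card_cartesian_product card_Un_disjoint algebra_simps)
  have "card ?W = card Q + card X + card T"
    using disjoint by (simp add: card_Un_disjoint Int_Un_distrib2)
  then have ww: "(\<Sum>p\<in>?W \<times> ?W. ?h p) \<le> (card Q + card X + card T)\<^sup>2"
    using sum_hit_ratio_le_card[of "?W \<times> ?W" \<G> C]
    by (simp add: card_cartesian_product power2_eq_square)
  have un: "(\<Sum>p\<in>A \<union> B. ?h p) \<le> (\<Sum>p\<in>A. ?h p) + (\<Sum>p\<in>B. ?h p)" if "finite A" "finite B" for A B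
    using that by (subst sum_Un) (auto intro: sum_nonneg)
  \<comment> \<open>This cover also contains pairs with equal entries; nonnegative summands make the
    overcount harmless.\<close>
  have "gbc \<G> C \<le> (\<Sum>p\<in>S \<times> T \<union> (T \<times> S \<union> (?D \<union> (S \<times> ?Y \<union> (?Y \<times> S \<union> ?W \<times> ?W)))). ?h p)"
    unfolding gbc_eq_sum_hit_ratio using finD by (intro sum_mono2) auto
  also have "\<dots> \<le> (\<Sum>p\<in>S \<times> T. ?h p) + ((\<Sum>p\<in>T \<times> S. ?h p) + ((\<Sum>p\<in>?D. ?h p)
      + ((\<Sum>p\<in>S \<times> ?Y. ?h p) + ((\<Sum>p\<in>?Y \<times> S. ?h p) + (\<Sum>p\<in>?W \<times> ?W. ?h p)))))"
    using finD by (intro order_trans[OF un] add_left_mono) auto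
  finally show ?thesis
    using st ts ss sy ww by (simp add: algebra_simps)
qed

text \<open>Remainder targets have no responsible node, so no choice of \<open>C\<close> reduces
  \<open>missed C\<close> below their number.\<close>

lemma card_unmissed_le_missed: "card {t \<in> T. \<kappa> t \<notin> X} \<le> missed C"
  unfolding missed_def by (intro card_mono) auto

lemma missed_insert:
  assumes "x \<in> X - C"
  shows "missed C = missed (insert x C) + card {t \<in> T. \<kappa> t = x}"
proof -
  have "{t \<in> T. \<kappa> t \<notin> C \<inter> X} = {t \<in> T. \<kappa> t \<notin> insert x C \<inter> X} \<union> {t \<in> T. \<kappa> t = x}"
    using assms by auto
  moreover have "{t \<in> T. \<kappa> t \<notin> insert x C \<inter> X} \<inter> {t \<in> T. \<kappa> t = x} = {}"
    using assms by auto
  ultimately show ?thesis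
    unfolding missed_def by (simp add: card_Un_disjoint)
qed

section \<open>Optimum and greedy outcome\<close>

lemma mbc_opt_ge:
  assumes "card Q = k"
  shows "scale \<le> mbc_opt \<G> (\<lambda>_. 1) (real k)"
proof -
  have "{C. mbc_feasible \<G> (\<lambda>_. 1) (real k) C} \<subseteq> Pow (verts \<G>)"
    by (auto simp: mbc_feasible_def)
  then have "finite {C. mbc_feasible \<G> (\<lambda>_. 1) (real k) C}"
    by (rule finite_subset) simp
  moreover have "mbc_feasible \<G> (\<lambda>_. 1) (real k) Q"
    using assms by (auto simp: mbc_feasible_def)
  ultimately have "gbc \<G> Q \<le> mbc_opt \<G> (\<lambda>_. 1) (real k)"
    unfolding mbc_opt_def by (intro Max_ge) auto
  moreover have "cov Q = 1" using nonempty by (simp add: cov_def)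
  ultimately show ?thesis using gbc_ge[of Q] by simp
qed

text \<open>Here \<open>\<beta>\<close> bounds the remainder fraction from below and
  \<open>\<delta>\<close> is the relative error of \<open>cov\<close> as a proxy for
  \<open>gbc\<close>. Since \<open>\<delta>\<close> is below the margin
  \<open>\<beta> / (k * m)\<close> by which a good node of \<open>X\<close> beats a fourth node of
  \<open>Q\<close>, comparing \<open>cov\<close> decides the comparison of \<open>gbc\<close>, and
  the bound holds however ties are broken.\<close>

lemma greedy_returns_low_coverage:
  fixes \<beta> \<delta> :: real
  assumes card: "card Q = k" "card X = k" and m: "k = m + 4" "m > 0"
    and progress: "\<And>I. I \<subset> X \<Longrightarrow>
      \<exists>x \<in> X - I. card {t \<in> T. \<kappa> t \<notin> I} \<le> m * card {t \<in> T. \<kappa> t = x}"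
    and rest: "\<beta> * card T \<le> card {t \<in> T. \<kappa> t \<notin> X}"
    and gbc_le: "\<And>C. C \<subseteq> verts \<G> \<Longrightarrow> card C \<le> k \<Longrightarrow> gbc \<G> C \<le> scale * (cov C + \<delta>)"
    and \<delta>: "\<delta> < \<beta> / (k * m)"
  shows "\<exists>H. greedy_returns \<G> (\<lambda>_. 1) (real k) H \<and> gbc \<G> H \<le> scale * (1 - (1 - 3 / k) * \<beta> + \<delta>)"
proof -
  \<comment> \<open>Three is the maximal seed size: a seed may lie entirely in \<open>Q\<close>, and
    no greedy step adds a fourth node of \<open>Q\<close>.\<close>
  define P where "P C \<longleftrightarrow> card (C \<inter> Q) \<le> 3" for C
  have pos: "scale > 0" "card T > 0"
    using nonempty by (simp_all add: card_gt_0_iff)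
  have missed_ge: "\<beta> * card T \<le> missed C" for C
    using rest card_unmissed_le_missed[of C] by linarith
  have step: "P (insert u C)"
    if "P C" and C: "C \<subseteq> verts \<G>" "card C < k"
      and u: "is_arg_max (\<lambda>u. gbc \<G> (insert u C)) (\<lambda>u. u \<in> verts \<G> - C) u" for C u
  proof (rule ccontr)
    have finC: "finite C" using C(1) by (rule finite_subset) simp
    have uC: "u \<notin> C" using u by (simp add: is_arg_max_def)
    assume "\<not> P (insert u C)"
    then have uQ: "u \<in> Q" and j: "card (C \<inter> Q) = 3" and j': "card (insert u C \<inter> Q) = 4"
      using \<open>P C\<close> uC finC unfolding P_def by (cases "u \<in> Q"; simp)+
    \<comment> \<open>Fewer than \<open>k = card X\<close> nodes are chosen, so
      \<open>progress\<close> still finds a free node of \<open>X\<close>.\<close>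
    have "\<not> X \<subseteq> C" using C(2) card(2) card_mono[OF finC, of X] by linarith
    then have "C \<inter> X \<subset> X" by auto
    from progress[OF this] obtain x where x: "x \<in> X - C"
      and f: "missed C \<le> m * card {t \<in> T. \<kappa> t = x}"
      by (auto simp: missed_def)
    define f where "f = card {t \<in> T. \<kappa> t = x}"
    have "insert u C \<inter> X = C \<inter> X" "insert x C \<inter> Q = C \<inter> Q"
      using uQ x disjoint by auto
    then have cu: "cov (insert u C) = 1 - (1 - 4 / k) * (missed C / card T)"
      and cx: "cov (insert x C) = 1 - (1 - 3 / k) * ((real (missed C) - f) / card T)"
      using missed_insert[OF x] card j j' by (simp_all add: cov_def missed_def f_def)
    have "\<beta> \<le> missed C / card T"
      using missed_ge[of C] pos by (simp add: pos_le_divide_eq)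
    from divide_right_mono[OF this, of "k * m"]
    have "\<beta> / (real k * m) \<le> missed C / (k * m * card T)"
      by (simp add: mult_ac)
    \<comment> \<open>By \<open>k = m + 4\<close> the gap equals
      \<open>((m + 1) * f - missed C) / (k * card T)\<close>, and
      \<open>m * f \<ge> missed C\<close> leaves at least \<open>missed C / m\<close> in the
      numerator. With \<open>k = m + 3\<close> the same estimate would only give a gap of at least
      0.\<close>
    also have "\<dots> \<le> cov (insert x C) - cov (insert u C)"
    proof -
      have "real (missed C) \<le> m * f" using f unfolding f_def[symmetric] by (metis of_nat_le_iff of_nat_mult)
      from mult_left_mono[OF this, of "real m + 1"]
      have "missed C + real m * missed C \<le> (real m + 1) * (m * f)"
        by (simp add: algebra_simps)
      then have "missed C / real m \<le> (real m + 1) * f - missed C"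
        using m by (simp add: field_simps)
      then have "(missed C / real m) / (k * card T) \<le> ((real m + 1) * f - missed C) / (k * card T)"
        by (intro divide_right_mono) auto
      also have "\<dots> = cov (insert x C) - cov (insert u C)"
      proof -
        have km: "1 - 4 / real k = m / real k" "1 - 3 / real k = (real m + 1) / real k" and "k > 0"
          using m by (simp_all add: field_simps)
        then show ?thesis
          unfolding cu cx km using pos(2) by (simp add: field_simps) (simp flip: add_divide_distrib)
      qed
      finally show ?thesis by (simp add: mult_ac)
    qed
    finally have "cov (insert u C) + \<delta> < cov (insert x C)" using \<delta> by linarith
    then have "scale * (cov (insert u C) + \<delta>) < scale * cov (insert x C)"
      using pos(1) by (rule mult_strict_left_mono)
    moreover have "gbc \<G> (insert u C) \<le> scale * (cov (insert u C) + \<delta>)"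
      using C uQ finC uC by (intro gbc_le) auto
    ultimately have "gbc \<G> (insert u C) < gbc \<G> (insert x C)"
      using gbc_ge[of "insert x C"] by linarith
    then show False using u x by (auto simp: is_arg_max_def)
  qed
  define R where "R H \<longleftrightarrow> H \<subseteq> verts \<G> \<and> card H \<le> k \<and> P H" for H
  have "R D" if seed: "C\<^sub>0 \<in> greedy_seeds \<G> (\<lambda>_. 1) (real k)"
    and D: "greedy_loop \<G> (\<lambda>_. 1) (real k) C\<^sub>0 (verts \<G> - C\<^sub>0) D" for C\<^sub>0 D
  proof -
    have C0: "C\<^sub>0 \<subseteq> verts \<G>" "card C\<^sub>0 \<le> 3" "card C\<^sub>0 \<le> k"
      using seed by (auto simp: greedy_seeds_def)
    have "finite C\<^sub>0" using C0(1) by (rule finite_subset) simp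
    then have "P C\<^sub>0" using C0 card_mono[of C\<^sub>0 "C\<^sub>0 \<inter> Q"] by (auto simp: P_def)
    show ?thesis unfolding R_def
    proof (rule greedy_loop_unit_cost_invariant[OF D, where P = P])
      show "P (insert u C)" if "P C" "C \<subseteq> verts \<G>" "card C < k"
        "is_arg_max (\<lambda>u. gbc \<G> (insert u C)) (\<lambda>u. u \<in> verts \<G> - C) u" for C u
        using that by (rule step)
    qed (use C0 \<open>P C\<^sub>0\<close> in auto)
  qed
  moreover have "finite (greedy_seeds \<G> (\<lambda>_. 1) (real k))"
    by (rule finite_subset[of _ "Pow (verts \<G>)"]) (auto simp: greedy_seeds_def)
  moreover have "R {}" by (simp add: R_def P_def)
  ultimately obtain H where H: "greedy_returns \<G> (\<lambda>_. 1) (real k) H" "R H"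
    unfolding greedy_returns_def
    using greedy_scan_exists[of "greedy_seeds \<G> (\<lambda>_. 1) (real k)" R "{}" \<G> "\<lambda>_. 1" "real k"] by auto
  have "(1 - 3 / k) * \<beta> \<le> (1 - 3 / k) * (missed H / card T)"
    using missed_ge[of H] pos m by (intro mult_left_mono) (auto simp: field_simps)
  also have "\<dots> \<le> (1 - card (H \<inter> Q) / card Q) * (missed H / card T)"
  proof -
    have "real (card (H \<inter> Q)) / k \<le> 3 / k"
      using H(2) by (intro divide_right_mono) (auto simp: R_def P_def)
    then show ?thesis using card by (intro mult_right_mono) auto
  qed
  finally have "cov H \<le> 1 - (1 - 3 / k) * \<beta>" by (simp add: cov_def)
  then have "scale * (cov H + \<delta>) \<le> scale * (1 - (1 - 3 / k) * \<beta> + \<delta>)"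
    using pos(1) by (intro mult_left_mono) auto
  moreover have "gbc \<G> H \<le> scale * (cov H + \<delta>)"
    using H(2) gbc_le by (simp add: R_def)
  ultimately show ?thesis using H(1) by force
qed

text \<open>With \<open>card S = (card T)\<^sup>2\<close> the error terms of \<open>gbc_le\<close>
  sum to at most \<open>14 * k * (card T)\<^sup>2\<close>, while \<open>scale\<close> is
  \<open>2 * (card T) ^ 3\<close>; the quotient is \<open>7 * k / card T\<close>.\<close>

lemma gbc_le_cov_plus:
  assumes "card Q = k" "card X = k" "k \<ge> 1" "card S = (card T)\<^sup>2" "2 * k \<le> card T"
    and "C \<subseteq> verts \<G>" "card C \<le> k"
  shows "gbc \<G> C \<le> scale * (cov C + 7 * k / card T)"
proof -
  let ?M = "card T"
  have M: "?M \<le> ?M\<^sup>2" by (simp add: power2_eq_square)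
  have "(k + k + ?M)\<^sup>2 \<le> (2 * ?M)\<^sup>2" using assms(5) by (intro power_mono) auto
  also have "\<dots> \<le> 4 * (k * ?M\<^sup>2)" using assms(3) by (simp add: power_mult_distrib)
  finally have "(k + k + ?M)\<^sup>2 \<le> 4 * (k * ?M\<^sup>2)" .
  moreover have "2 * k * (?M\<^sup>2 + ?M) + 2 * k * ?M\<^sup>2 + 2 * ?M\<^sup>2 * (k + k) = 8 * (k * ?M\<^sup>2) + 2 * (k * ?M)"
    by (simp add: algebra_simps)
  moreover have "k * ?M \<le> k * ?M\<^sup>2" using M by (rule mult_le_mono2)
  ultimately have "2 * k * (?M\<^sup>2 + ?M) + 2 * k * ?M\<^sup>2 + 2 * ?M\<^sup>2 * (k + k) + (k + k + ?M)\<^sup>2 \<le> 14 * k * ?M\<^sup>2"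
    by linarith
  then have "real (2 * k * (?M\<^sup>2 + ?M) + 2 * k * ?M\<^sup>2 + 2 * ?M\<^sup>2 * (k + k) + (k + k + ?M)\<^sup>2)
    \<le> real (14 * k * ?M\<^sup>2)" by (rule of_nat_mono)
  also have "\<dots> = scale * (7 * k / ?M)" using nonempty assms(4) by simp
  finally show ?thesis
    using gbc_le[OF assms(6,7)] assms by (simp add: distrib_left)
qed

end

section \<open>Geometric block sizes\<close>

text \<open>The factor \<open>m ^ k\<close> makes all leftovers \<open>a i\<close>, that is
  \<open>card T\<close> times \<open>(1 - 1/m) ^ i\<close>, integers, and \<open>L\<close> scales
  \<open>T\<close> freely. The progress property covers every proper subset \<open>I\<close> of
  \<open>X\<close>, because seeds and greedy may take nodes of \<open>X\<close> in any
  order.\<close>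

lemma layered_graph_exists:
  fixes k m L :: nat
  assumes "m > 0" "k > 0" "L > 0"
  obtains S Q X T :: "nat set" and \<kappa> where
    "layered_graph S Q X T \<kappa>" "card Q = k" "card X = k" "card T = L * m ^ k" "card S = (card T)\<^sup>2"
    "\<And>I. I \<subset> X \<Longrightarrow> \<exists>x \<in> X - I. card {t \<in> T. \<kappa> t \<notin> I} \<le> m * card {t \<in> T. \<kappa> t = x}"
    "L * (m - 1) ^ k \<le> card {t \<in> T. \<kappa> t \<notin> X}"
proof -
  define a where "a i = L * m ^ (k - i) * (m - 1) ^ i" for i
  define M where "M = L * m ^ k"
  \<comment> \<open>The node \<open>k + i\<close> of \<open>X\<close> owns the targets with offset in \<open>{a (Suc i)..<a i}\<close>, so \<open>a i\<close> targets are
    left over by the first \<open>i\<close> nodes.\<close>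
  define X where "X = {k..<2 * k}"
  define T where "T = {2 * k..<2 * k + M}"
  define S where "S = {2 * k + M..<2 * k + M + M\<^sup>2}"
  define \<kappa> where "\<kappa> t = (if t - 2 * k < a k then t else k + (LEAST i. a (Suc i) \<le> t - 2 * k))" for t
  have a0: "a 0 = M" by (simp add: a_def M_def)
  have a_step: "a i = m * c \<and> a (Suc i) = (m - 1) * c"
    if "i < k" "c = L * m ^ (k - Suc i) * (m - 1) ^ i" for i c
  proof -
    have "m ^ (k - i) = m * m ^ (k - Suc i)" using that(1) by (simp flip: power_Suc add: Suc_diff_Suc)
    then show ?thesis using that(2) by (simp add: a_def)
  qed
  have a_Suc: "a (Suc i) \<le> a i" if "i < k" for i
    using a_step[OF that refl] by simp
  have a_anti: "a j \<le> a i" if "i \<le> j" "j \<le> k" for i j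
    using that
  proof (induction j rule: dec_induct)
    case (step j)
    then show ?case using a_Suc[of j] by simp
  qed simp
  \<comment> \<open>The index \<open>k - 1\<close> witnesses that the \<open>LEAST\<close> in
    \<open>\<kappa>\<close> exists and is below \<open>k\<close>.\<close>
  have ex: "a (Suc (k - 1)) \<le> t - 2 * k" if "a k \<le> t - 2 * k" for t
    using that assms by simp
  have kX: "\<kappa> t \<in> X" if "a k \<le> t - 2 * k" for t
    using Least_le[of "\<lambda>i. a (Suc i) \<le> t - 2 * k", OF ex[OF that]] that assms
    by (simp add: \<kappa>_def X_def)
  have fibre: "\<kappa> t = k + i" if t: "t \<in> T" and i: "i < k" "a (Suc i) \<le> t - 2 * k" "t - 2 * k < a i" for t i
  proof -
    have "a k \<le> t - 2 * k" using a_anti[of "Suc i" k] i by simp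
    moreover have "(LEAST i. a (Suc i) \<le> t - 2 * k) = i"
    proof (rule Least_equality)
      fix j assume "a (Suc j) \<le> t - 2 * k"
      then have "a (Suc j) < a i" using i by simp
      then show "i \<le> j" using a_anti[of "Suc j" i] i by (metis leD not_less_eq_eq less_imp_le)
    qed (fact i(2))
    ultimately show ?thesis by (simp add: \<kappa>_def)
  qed
  show ?thesis
  proof
    show "layered_graph S {..<k} X T \<kappa>"
    proof
      show "S \<noteq> {}" "{..<k} \<noteq> {}" "T \<noteq> {}" using assms by (auto simp: S_def T_def M_def)
      show "\<kappa> t \<in> X \<or> \<kappa> t = t" for t
        using kX[of t] by (cases "t - 2 * k < a k") (auto simp: \<kappa>_def)
    qed (auto simp: S_def T_def X_def)
    show "card T = L * m ^ k" "card S = (card T)\<^sup>2" "card X = k" "card {..<k} = k"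
      by (simp_all add: S_def T_def X_def M_def)
    show "\<exists>x \<in> X - I. card {t \<in> T. \<kappa> t \<notin> I} \<le> m * card {t \<in> T. \<kappa> t = x}" if I: "I \<subset> X" for I
    proof -
      obtain x where "x \<in> X" "x \<notin> I" using I by auto
      then have x: "k + (x - k) \<notin> I" "x - k < k" by (auto simp: X_def)
      \<comment> \<open>All blocks before the first free index \<open>i\<close> are owned by nodes
        of \<open>I\<close>, so at most \<open>a i\<close> targets are missed; block
        \<open>i\<close> alone contains \<open>a i / m\<close> of them.\<close>
      define i where "i = (LEAST i. k + i \<notin> I)"
      have i: "k + i \<notin> I" "i < k"
        using LeastI[of "\<lambda>i. k + i \<notin> I", OF x(1)] Least_le[of "\<lambda>i. k + i \<notin> I", OF x(1)] x(2)
        by (auto simp: i_def)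
      have less: "k + j \<in> I" if "j < i" for j
        using that not_less_Least unfolding i_def by blast
      define c where "c = L * m ^ (k - Suc i) * (m - 1) ^ i"
      note c = a_step[OF i(2) c_def]
      have "{t \<in> T. \<kappa> t \<notin> I} \<subseteq> {2 * k..<2 * k + a i}"
      proof (rule subsetI, rule ccontr)
        fix t assume t: "t \<in> {t \<in> T. \<kappa> t \<notin> I}" "t \<notin> {2 * k..<2 * k + a i}"
        then have q: "a i \<le> t - 2 * k" "t - 2 * k < a 0" by (auto simp: T_def a0)
        then have "i \<noteq> 0" by (metis leD)
        then have "a (Suc (i - 1)) \<le> t - 2 * k" using q by simp
        then have "(LEAST j. a (Suc j) \<le> t - 2 * k) \<le> i - 1" by (rule Least_le)
        then have "k + (LEAST j. a (Suc j) \<le> t - 2 * k) \<in> I"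
          using \<open>i \<noteq> 0\<close> by (intro less) simp
        moreover have "a k \<le> t - 2 * k" using a_anti[of i k] i q by simp
        ultimately show False using t by (simp add: \<kappa>_def)
      qed
      from card_mono[OF _ this] have "card {t \<in> T. \<kappa> t \<notin> I} \<le> a i" by simp
      also have "a i = m * (a i - a (Suc i))"
        using c assms(1) by (simp flip: diff_mult_distrib)
      also have "a i - a (Suc i) \<le> card {t \<in> T. \<kappa> t = k + i}"
      proof -
        have "{2 * k + a (Suc i)..<2 * k + a i} \<subseteq> {t \<in> T. \<kappa> t = k + i}"
          using fibre i a_anti[of 0 i] by (auto simp: T_def a0)
        from card_mono[OF _ this] show ?thesis by (simp add: T_def)
      qed
      finally have "card {t \<in> T. \<kappa> t \<notin> I} \<le> m * card {t \<in> T. \<kappa> t = k + i}" by simp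
      then show ?thesis using i by (intro bexI[of _ "k + i"]) (auto simp: X_def)
    qed
    have "{2 * k..<2 * k + a k} \<subseteq> {t \<in> T. \<kappa> t \<notin> X}"
      using a_anti[of 0 k] by (auto simp: T_def X_def a0 \<kappa>_def)
    from card_mono[OF _ this] show "L * (m - 1) ^ k \<le> card {t \<in> T. \<kappa> t \<notin> X}"
      by (simp add: T_def a_def)
  qed
qed

section \<open>Choice of the parameters\<close>

theorem theorem2:
  fixes \<epsilon> :: real
  assumes "\<epsilon> > 0"
  shows "\<exists>(G :: (nat, nat \<times> nat) pre_digraph) (k :: nat) H.
    k \<ge> 1 \<and> mbc_instance G (\<lambda>_. 1) (real k) \<and>
    mbc_opt G (\<lambda>_. 1) (real k) > 0 \<and>
    greedy_returns G (\<lambda>_. 1) (real k) H \<and>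
    gbc G H \<le> (1 - 1 / exp 1 + \<epsilon>) * mbc_opt G (\<lambda>_. 1) (real k)"
proof -
  \<comment> \<open>This is the bound on the greedy ratio for \<open>k = m + 4\<close> and
    \<open>\<beta> = (1 - 1/m) ^ k\<close>, without the error \<open>\<delta>\<close>.\<close>
  let ?r = "\<lambda>m. 1 - (1 - 3 / (real m + 4)) * (1 - 1 / real m) ^ (m + 4)"
  have "?r \<longlonglongrightarrow> 1 - exp (- 1)"
    by real_asymp
  then have "?r \<longlonglongrightarrow> 1 - 1 / exp 1"
    by (simp add: exp_minus inverse_eq_divide)
  then have "\<forall>\<^sub>F m in sequentially. ?r m < 1 - 1 / exp 1 + \<epsilon> / 2"
    using assms by (intro order_tendstoD(2)) auto
  then have "\<forall>\<^sub>F m in sequentially. ?r m < 1 - 1 / exp 1 + \<epsilon> / 2 \<and> m \<ge> 2"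
    using eventually_ge_at_top[of 2] by (rule eventually_conj)
  then obtain m :: nat where m: "?r m < 1 - 1 / exp 1 + \<epsilon> / 2" "m \<ge> 2"
    using eventually_happens'[OF sequentially_bot] by blast
  define k where "k = m + 4"
  define \<beta> where "\<beta> = (1 - 1 / real m) ^ k"
  have \<beta>: "\<beta> > 0" using m by (simp add: \<beta>_def)
  \<comment> \<open>\<open>L\<close> is chosen after \<open>m\<close>, as it must push the error
    below the margin \<open>\<beta> / (k * m)\<close> as well as below
    \<open>\<epsilon> / 2\<close>.\<close>
  have "(\<lambda>L. 7 * real k / real L) \<longlonglongrightarrow> 0" by real_asymp
  then have "\<forall>\<^sub>F L in sequentially. 7 * real k / real L < min (\<epsilon> / 2) (\<beta> / (real k * m))"
    using assms \<beta> m by (intro order_tendstoD(2)) (auto simp: k_def)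
  then have "\<forall>\<^sub>F L in sequentially. 7 * real k / real L < min (\<epsilon> / 2) (\<beta> / (real k * m)) \<and> L \<ge> 2 * k"
    using eventually_ge_at_top[of "2 * k"] by (rule eventually_conj)
  then obtain L :: nat where L: "7 * real k / real L < min (\<epsilon> / 2) (\<beta> / (real k * m))" "L \<ge> 2 * k"
    using eventually_happens'[OF sequentially_bot] by blast
  have pos: "m > 0" "k > 0" "L > 0" using m(2) L(2) by (auto simp: k_def)
  obtain S Q X T :: "nat set" and \<kappa> where
    "layered_graph S Q X T \<kappa>" and cards: "card Q = k" "card X = k" "card T = L * m ^ k" "card S = (card T)\<^sup>2"
    and progress: "\<And>I. I \<subset> X \<Longrightarrow> \<exists>x \<in> X - I. card {t \<in> T. \<kappa> t \<notin> I} \<le> m * card {t \<in> T. \<kappa> t = x}"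
    and rest: "L * (m - 1) ^ k \<le> card {t \<in> T. \<kappa> t \<notin> X}"
    by (rule layered_graph_exists[OF pos]) blast
  interpret layered_graph S Q X T \<kappa> by fact
  define \<delta> where "\<delta> = 7 * real k / card T"
  have LT: "L \<le> card T" using m by (simp add: cards)
  have "\<delta> \<le> 7 * real k / real L"
    unfolding \<delta>_def using LT pos(3) by (intro divide_left_mono) auto
  then have \<delta>: "\<delta> < \<epsilon> / 2" "\<delta> < \<beta> / (real k * m)" using L(1) by auto
  have "\<beta> * card T = real (L * (m - 1) ^ k)"
    using m by (simp add: \<beta>_def cards power_divide of_nat_diff diff_divide_distrib[symmetric]
        field_simps flip: power_mult_distrib)
  then have rest': "\<beta> * card T \<le> card {t \<in> T. \<kappa> t \<notin> X}"
    using rest by linarith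
  have le: "gbc \<G> C \<le> scale * (cov C + \<delta>)" if "C \<subseteq> verts \<G>" "card C \<le> k" for C
    unfolding \<delta>_def using cards(1,2) _ cards(4) _ that
    by (rule gbc_le_cov_plus) (use pos(2) L(2) LT in linarith)+
  obtain H where H: "greedy_returns \<G> (\<lambda>_. 1) (real k) H"
    "gbc \<G> H \<le> scale * (1 - (1 - 3 / k) * \<beta> + \<delta>)"
    using greedy_returns_low_coverage[OF cards(1,2) k_def pos(1) progress rest' le \<delta>(2)] by blast
  have scale: "scale > 0" using nonempty by (simp add: card_gt_0_iff)
  have opt: "scale \<le> mbc_opt \<G> (\<lambda>_. 1) (real k)" using cards(1) by (rule mbc_opt_ge)
  have "1 - (1 - 3 / k) * \<beta> + \<delta> \<le> 1 - 1 / exp 1 + \<epsilon>"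
    using m(1) \<delta>(1) by (simp add: k_def \<beta>_def)
  then have "gbc \<G> H \<le> scale * (1 - 1 / exp 1 + \<epsilon>)"
    using H(2) scale by (meson less_imp_le mult_left_mono order_trans)
  also have "\<dots> \<le> mbc_opt \<G> (\<lambda>_. 1) (real k) * (1 - 1 / exp 1 + \<epsilon>)"
    using opt assms by (intro mult_right_mono) auto
  finally show ?thesis
    using H(1) less_le_trans[OF scale opt] mbc_instance_G[of "real k"] pos(2)
    by (intro exI[of _ \<G>] exI[of _ k] exI[of _ H]) (simp add: mult.commute)
qed

end
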